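(* Let $r>0$, $0<p\le 1$, $d\in\mathbb{N}$. Then for every $n\in\mathbb{N}$ with $n<e^{d/8}$, $$\mathrm{err}(n,R_d^{r,p})\ \ge\ c_r\left(\frac{1}{8\log(2n)}\right)^{r(1/p-1)},$$ where $c_r=2^{-r}\,\dfrac{\Gamma(r+1-m)}{\Gamma(r+1)}$, $m$ is the largest integer strictly less than $r$, and $\Gamma(z)=\int_0^\infty x^{z-1}e^{-x}\,dx$ ($z>0$) is the gamma function. (In particular $c_r=2^{-r}/r!$ for $r\in\mathbb{N}$.)
   Context: $\|a\|_p=(\sum_{i=1}^d|a_i|^p)^{1/p}$. For $r>0$ let $m$ be the largest integer strictly less than $r$ and $\beta=r-m\in(0,1]$. $B^{\mathrm{Lip}(r)}$ is the set of all $m$ times continuously differentiable $g:[-1,1]\to\mathbb{R}$ with $\max\{\|g\|_\infty,\|g^{(1)}\|_\infty,\dots,\|g^{(m)}\|_\infty,|g^{(m)}|_\beta\}\le 1$, where $|g^{(m)}|_\beta=\sup_{u\ne v\in[-1,1]}\frac{|g^{(m)}(u)-g^{(m)}(v)|}{2\min\{1,|u-v|\}^\beta}$. $R_d^{r,p}=\{f:[-1,1]^d\to\mathbb{R}:\ f(x)=g(a^{T}x),\ g\in B^{\mathrm{Lip}(r)},\ a\in\mathbb{R}^d,\ \|a\|_p=1\}$. For a class $F_d\subset C([-1,1]^d)$, a deterministic algorithm using at most $n$ function values is a map $S_n:F_d\to C([-1,1]^d)$ of the form $S_n(f)=\phi(f(x_1),\dots,f(x_n))$ with an arbitrary map $\phi:\mathbb{R}^n\to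 C([-1,1]^d)$, where $x_1\in[-1,1]^d$ is fixed (independent of $f$) and $x_i=\psi_i(f(x_1),\dots,f(x_{i-1}))$ for $i=2,\dots,n$ with arbitrary maps $\psi_i:\mathbb{R}^{i-1}\to[-1,1]^d$. The $n$th minimal worst-case error is $\mathrm{err}(n,F_d)=\inf_{S_n}\sup_{f\in F_d}\|f-S_n(f)\|_\infty$, the infimum being over all such algorithms and $\|\cdot\|_\infty$ the sup norm on $[-1,1]^d$. *)

theory Defs
  imports "HOL-Analysis.Analysis"
begin

text \<open>
  A function with domain \<open>S\<close> is represented by an arbitrary total function; every notion
  below depends only on its values on \<open>S\<close>. Suprema that may be infinite are taken in
  \<^typ>\<open>ereal\<close>, since an unbounded supremum in \<^typ>\<open>real\<close> is unspecified.
\<close>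

definition sup_norm_on :: "'a set \<Rightarrow> ('a \<Rightarrow> real) \<Rightarrow> ereal" where
  "sup_norm_on S f = (SUP x\<in>S. ereal \<bar>f x\<bar>)"

definition cube :: "(real ^ 'd::finite) set" where
  "cube = {x. \<forall>i. x $ i \<in> {-1..1}}"

definition p_norm :: "real \<Rightarrow> real ^ 'd::finite \<Rightarrow> real" where
  "p_norm p a = (\<Sum>i\<in>UNIV. \<bar>a $ i\<bar> powr p) powr (1 / p)"

text \<open>For \<open>r > 0\<close> the largest integer strictly less than \<open>r\<close> is nonnegative.\<close>

definition lip_order :: "real \<Rightarrow> nat" where
  "lip_order r = (GREATEST k. real k < r)"

definition lip_exponent :: "real \<Rightarrow> real" where
  "lip_exponent r = r - real (lip_order r)"

text \<open>The \<open>k\<close>-th derivative on \<open>[-1,1]\<close>, one-sided at the end points.\<close>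

definition nth_deriv :: "nat \<Rightarrow> (real \<Rightarrow> real) \<Rightarrow> real \<Rightarrow> real" where
  "nth_deriv k = (\<lambda>h x. vector_derivative h (at x within {-1..1})) ^^ k"

definition continuously_differentiable :: "nat \<Rightarrow> (real \<Rightarrow> real) \<Rightarrow> bool" where
  "continuously_differentiable m g \<longleftrightarrow>
     (\<forall>k<m. nth_deriv k g differentiable_on {-1..1}) \<and>
     continuous_on {-1..1} (nth_deriv m g)"

definition hoelder_seminorm :: "real \<Rightarrow> (real \<Rightarrow> real) \<Rightarrow> ereal" where
  "hoelder_seminorm \<beta> h =
     (SUP (u, v)\<in>{(u, v). u \<in> {-1..1} \<and> v \<in> {-1..1} \<and> u \<noteq> v}.
        ereal (\<bar>h u - h v\<bar> / (2 * min 1 \<bar>u - v\<bar> powr \<beta>)))"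

definition lip_norm :: "real \<Rightarrow> (real \<Rightarrow> real) \<Rightarrow> ereal" where
  "lip_norm r g =
     max (Max ((\<lambda>k. sup_norm_on {-1..1} (nth_deriv k g)) ` {..lip_order r}))
         (hoelder_seminorm (lip_exponent r) (nth_deriv (lip_order r) g))"

definition lip_ball :: "real \<Rightarrow> (real \<Rightarrow> real) set" where
  "lip_ball r = {g. continuously_differentiable (lip_order r) g \<and> lip_norm r g \<le> 1}"

definition ridge_class :: "real \<Rightarrow> real \<Rightarrow> (real ^ 'd::finite \<Rightarrow> real) set" where
  "ridge_class r p =
     {f. \<exists>g\<in>lip_ball r. \<exists>a. p_norm p a = 1 \<and> (\<forall>x\<in>cube. f x = g (a \<bullet> x))}"

text \<open>
  A vector in \<open>\<real>\<^sup>i\<close> is a list of length \<open>i\<close>, and the maps choosing the sample points are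
  combined into one map \<open>\<psi>\<close> on lists: given the first \<open>i - 1\<close> function values \<open>ys\<close>, the
  \<open>i\<close>-th point is \<open>\<psi> ys\<close>. In particular the first point \<open>\<psi> []\<close> does not depend on \<open>f\<close>.
\<close>

primrec information ::
  "(real list \<Rightarrow> real ^ 'd::finite) \<Rightarrow> (real ^ 'd \<Rightarrow> real) \<Rightarrow> nat \<Rightarrow> real list" where
  "information \<psi> f 0 = []"
| "information \<psi> f (Suc i) = information \<psi> f i @ [f (\<psi> (information \<psi> f i))]"

definition algorithms ::
  "nat \<Rightarrow> ((real ^ 'd::finite \<Rightarrow> real) \<Rightarrow> (real ^ 'd \<Rightarrow> real)) set" where
  "algorithms n =
     {S. \<exists>\<psi> \<phi>. (\<forall>ys. length ys < n \<longrightarrow> \<psi> ys \<in> cube) \<and>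
               (\<forall>ys. length ys = n \<longrightarrow> continuous_on cube (\<phi> ys)) \<and>
               S = (\<lambda>f. \<phi> (information \<psi> f n))}"

definition err :: "nat \<Rightarrow> (real ^ 'd::finite \<Rightarrow> real) set \<Rightarrow> ereal" where
  "err n F = (INF S\<in>algorithms n. SUP f\<in>F. sup_norm_on cube (\<lambda>x. f x - S f x))"

definition lower_const :: "real \<Rightarrow> real" where
  "lower_const r = 2 powr (- r) * (Gamma (r + 1 - real (lip_order r)) / Gamma (r + 1))"

end

theory Submission imports Defs begin

text \<open>
  The lower bound comes from a fooling argument: whatever \<open>n\<close> points an algorithm visits while
  it only sees the value \<open>0\<close>, there is a ridge function \<open>f\<close> vanishing at all of them that is large
  somewhere in the cube. Since \<open>f\<close> and \<open>-f\<close> yield the same information, the algorithm returns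
  the same approximation for both, and its error on one of them is at least the maximum of \<open>f\<close>
  (lemma \<open>err_ge_fooling\<close>).

  To build \<open>f\<close>, fix a set \<open>K\<close> of \<open>k\<close> coordinates and let the direction \<open>a\<close> have entries
  \<open>\<epsilon>\<^sub>j k\<^bsup>-1/p\<^esup>\<close> with signs \<open>\<epsilon>\<^sub>j\<close> on \<open>K\<close>
  and \<open>0\<close> elsewhere, so that its \<open>p\<close>-norm is \<open>1\<close>.
  On the cube, \<open>a \<bullet> x\<close> attains its maximum \<open>2b = k\<^bsup>1-1/p\<^esup>\<close> at the sign vector itself. By
  Hoeffding's inequality a random choice of signs satisfies \<open>a \<bullet> x > b\<close> at a given point \<open>x\<close> of
  the cube with probability at most \<open>exp (-k/8)\<close>; hence if \<open>k \<ge> 8 ln n\<close>, some choice keeps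
  \<open>a \<bullet> x \<le> b\<close> at all \<open>n\<close> points simultaneously (lemma \<open>exists_signs_inner_le_half\<close>).
  The profile \<open>g(t) = C max(0, t - b)\<^bsup>r\<^esup>\<close> then vanishes at the visited points, and
  \<open>C = \<Gamma>(r+1-m) / \<Gamma>(r+1)\<close> is the reciprocal of \<open>r(r-1)\<cdots>(r-m+1)\<close>, which is exactly what
  makes the \<open>m\<close>-th derivative equal to \<open>max(0, t - b)\<^bsup>\<beta>\<^esup>\<close> and puts \<open>g\<close> into the Lipschitz ball
  (lemma \<open>truncated_power_in_lip_ball\<close>). The maximum of \<open>f\<close> is
  \<open>C b\<^bsup>r\<^esup> = C 2\<^bsup>-r\<^esup> k\<^bsup>-r(1/p-1)\<^esup>\<close>. It remains to choose \<open>k\<close> as the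
  least integer above \<open>8 ln n\<close>: it is at most the dimension because \<open>n < exp (d/8)\<close>, and at most
  \<open>8 ln (2n)\<close> because \<open>8 ln 2 \<ge> 1\<close>.
\<close>

section \<open>Truncated powers\<close>

text \<open>
  The exponent exceeds \<open>1\<close>, so at the kink the difference quotient is dominated by
  \<open>\<bar>h\<bar> powr (s - 1)\<close>, which tends to \<open>0\<close>; away from the kink the function is locally zero
  or a plain power.
\<close>

lemma has_real_derivative_truncated_power:
  fixes s b x :: real
  assumes "s > 1"
  shows "((\<lambda>t. max 0 (t - b) powr s) has_real_derivative s * max 0 (x - b) powr (s - 1))
           (at x within A)"
proof -
  consider "x < b" | "x = b" | "x > b" by linarith
  then have "((\<lambda>t. max 0 (t - b) powr s) has_real_derivative s * max 0 (x - b) powr (s - 1)) (at x)"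
  proof cases
    case 1
    have "((\<lambda>t. 0) has_real_derivative s * max 0 (x - b) powr (s - 1)) (at x)"
      using 1 by simp
    then show ?thesis
      by (rule has_field_derivative_transform_within_open[where S = "{..<b}"]) (use 1 in auto)
  next
    case 3
    have "((\<lambda>t. (t - b) powr s) has_real_derivative s * max 0 (x - b) powr (s - 1)) (at x)"
      using 3 by (auto intro!: derivative_eq_intros)
    then show ?thesis
      by (rule has_field_derivative_transform_within_open[where S = "{b<..}"]) (use 3 in auto)
  next
    case 2
    have "((\<lambda>h. \<bar>h\<bar> powr (s - 1)) \<longlongrightarrow> \<bar>0\<bar> powr (s - 1)) (at (0::real))"
      using assms by (intro tendsto_powr2 tendsto_rabs tendsto_ident_at) auto
    then have lim: "((\<lambda>h. \<bar>h\<bar> powr (s - 1)) \<longlongrightarrow> 0) (at (0::real))" by simp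
    have "((\<lambda>h. max 0 h powr s / h) \<longlongrightarrow> 0) (at (0::real))"
    proof (rule Lim_null_comparison[OF _ lim], intro always_eventually allI)
      fix h :: real
      show "norm (max 0 h powr s / h) \<le> \<bar>h\<bar> powr (s - 1)"
        by (cases "h > 0") (simp add: powr_diff, simp add: max_absorb1)
    qed
    then show ?thesis using 2 by (simp add: DERIV_def)
  qed
  then show ?thesis by (rule has_field_derivative_at_within)
qed

text \<open>
  Hoelder continuity of a concave power follows from its subadditivity, and subadditivity follows
  by scaling the sum to \<open>1\<close> and using \<open>z \<le> z powr s\<close> on the unit interval.
\<close>

lemma abs_diff_powr_le:
  fixes u v s :: real
  assumes "0 \<le> u" "0 \<le> v" "0 < s" "s \<le> 1"
  shows "\<bar>u powr s - v powr s\<bar> \<le> \<bar>u - v\<bar> powr s"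
proof -
  have *: "(x + y) powr s \<le> x powr s + y powr s" if "0 \<le> x" "0 \<le> y" for x y :: real
  proof (cases "x + y = 0")
    case True
    then show ?thesis using that by simp
  next
    case False
    then have pos: "x + y > 0" using that by simp
    have le: "z \<le> z powr s" if "0 \<le> z" "z \<le> 1" for z :: real
      using powr_mono'[of s 1 z] that assms by (cases "z = 0") auto
    have "1 = x / (x + y) + y / (x + y)" using pos by (simp flip: add_divide_distrib)
    also have "\<dots> \<le> (x / (x + y)) powr s + (y / (x + y)) powr s"
      using that pos by (intro add_mono le) (auto simp: field_simps)
    also have "\<dots> = (x powr s + y powr s) / (x + y) powr s"
      using that pos by (simp add: powr_divide add_divide_distrib)
    finally show ?thesis using pos by (simp add: field_simps)
  qed
  show ?thesis
  proof (cases "u \<le> v")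
    case True
    then show ?thesis
      using *[of u "v - u"] powr_mono2[of s u v] assms by (simp add: abs_if)
  next
    case False
    then show ?thesis
      using *[of v "u - v"] powr_mono2[of s v u] assms by (simp add: abs_if)
  qed
qed

section \<open>Membership in the Lipschitz ball\<close>

lemma lip_order_bounds:
  assumes "r > 0"
  shows "real (lip_order r) < r" and "r \<le> real (lip_order r) + 1"
proof -
  have bd: "\<forall>k. real k < r \<longrightarrow> k \<le> nat \<lceil>r\<rceil>" by (auto simp: le_nat_iff) linarith
  have "real 0 < r" using assms by simp
  then show "real (lip_order r) < r"
    unfolding lip_order_def by (rule GreatestI_nat) (use bd in auto)
  have "\<not> real (Suc (lip_order r)) < r"
  proof
    assume "real (Suc (lip_order r)) < r"
    then have "Suc (lip_order r) \<le> lip_order r"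
      unfolding lip_order_def by (rule Greatest_le_nat) (use bd in auto)
    then show False by simp
  qed
  then show "r \<le> real (lip_order r) + 1" by simp
qed

lemma Gamma_falling:
  fixes r :: real
  assumes "real j < r + 1"
  shows "Gamma (r + 1) = (\<Prod>i<j. r - real i) * Gamma (r + 1 - real j)"
  using assms
proof (induction j)
  case 0
  then show ?case by simp
next
  case (Suc j)
  have "r - real j \<notin> \<int>\<^sub>\<le>\<^sub>0" using Suc.prems by (auto elim!: nonpos_Ints_cases)
  then have "Gamma (r - real j + 1) = (r - real j) * Gamma (r - real j)"
    by (rule Gamma_plus1)
  then have "Gamma (r + 1 - real j) = (r - real j) * Gamma (r + 1 - real (Suc j))"
    by (simp add: algebra_simps)
  then show ?case using Suc by simp
qed

lemma nth_deriv_truncated_power: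
  fixes r b c x :: real
  assumes "real j < r" "x \<in> {-1..1}"
  shows "nth_deriv j (\<lambda>t. c * max 0 (t - b) powr r) x
           = c * (\<Prod>i<j. r - real i) * max 0 (x - b) powr (r - real j)"
  using assms
proof (induction j arbitrary: x)
  case 0
  then show ?case by (simp add: nth_deriv_def)
next
  case (Suc j)
  let ?g = "\<lambda>t. c * max 0 (t - b) powr r"
  let ?P = "\<Prod>i<j. r - real i"
  have "((\<lambda>t. c * ?P * max 0 (t - b) powr (r - real j)) has_real_derivative
           c * ?P * ((r - real j) * max 0 (x - b) powr (r - real j - 1))) (at x within {-1..1})"
    using Suc.prems by (intro DERIV_cmult has_real_derivative_truncated_power) simp
  then have "(nth_deriv j ?g has_real_derivative
           c * ?P * ((r - real j) * max 0 (x - b) powr (r - real j - 1))) (at x within {-1..1})"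
    by (rule has_field_derivative_transform_within[where d = 1]) (use Suc in auto)
  then have "vector_derivative (nth_deriv j ?g) (at x within {-1..1})
      = c * ?P * ((r - real j) * max 0 (x - b) powr (r - real j - 1))"
    using Suc.prems unfolding has_real_derivative_iff_has_vector_derivative
    by (intro vector_derivative_within_cbox[of "-1" 1, simplified]) auto
  then show ?case by (simp add: nth_deriv_def algebra_simps)
qed

text \<open>
  The hypothesis on \<open>c\<close> normalises the top coefficient: the \<open>m\<close>-th derivative has
  coefficient at most \<open>1\<close> in absolute value. The lower derivatives then have smaller
  coefficients, because passing from the \<open>j\<close>-th to the \<open>m\<close>-th multiplies by factors \<open>r - i\<close> with
  \<open>i < m\<close>, each at least \<open>1\<close>. The shift is nonnegative, so the truncated power itself is at
  most \<open>1\<close> on the interval. Only a bound on \<open>\<bar>c\<bar>\<close> enters, so the result covers the negated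
  profile as well.
\<close>

lemma truncated_power_in_lip_ball:
  fixes r b c :: real
  assumes "r > 0" "b \<ge> 0" and c: "\<bar>c\<bar> \<le> Gamma (r + 1 - real (lip_order r)) / Gamma (r + 1)"
  shows "(\<lambda>t. c * max 0 (t - b) powr r) \<in> lip_ball r"
proof -
  define m where "m = lip_order r"
  define P where "P j = (\<Prod>i<j. r - real i)" for j :: nat
  let ?g = "\<lambda>t. c * max 0 (t - b) powr r"
  have m: "real m < r" "r \<le> real m + 1"
    using lip_order_bounds[OF \<open>r > 0\<close>] by (auto simp: m_def)
  have deriv: "nth_deriv j ?g x = c * P j * max 0 (x - b) powr (r - real j)"
    if "j \<le> m" "x \<in> {-1..1}" for j x
    using that m unfolding P_def by (intro nth_deriv_truncated_power) auto
  have Ppos: "P j > 0" if "j \<le> m" for j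
    unfolding P_def using that m by (intro prod_pos) auto
  have cPm: "\<bar>c\<bar> * P m \<le> 1"
  proof -
    have "Gamma (r + 1) = P m * Gamma (r + 1 - real m)"
      unfolding P_def using m by (intro Gamma_falling) simp
    moreover have "Gamma (r + 1 - real m) > 0" using m by (intro Gamma_real_pos) simp
    ultimately have "\<bar>c\<bar> \<le> 1 / P m" using c by (simp add: m_def)
    then show ?thesis using Ppos[of m] by (simp add: field_simps)
  qed
  have cP: "\<bar>c * P j\<bar> \<le> 1" if "j \<le> m" for j
  proof -
    have "P j \<le> P m"
    proof -
      have "P m = P j * (\<Prod>i\<in>{j..<m}. r - real i)"
        unfolding P_def lessThan_atLeast0 using that by (simp add: prod.atLeastLessThan_concat)
      moreover have "1 \<le> (\<Prod>i\<in>{j..<m}. r - real i)"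
      proof (rule prod_ge_1)
        fix i assume "i \<in> {j..<m}"
        then have "real i + 1 \<le> real m" by simp
        then show "1 \<le> r - real i" using m by linarith
      qed
      ultimately show ?thesis using Ppos[OF that] by simp
    qed
    then have "\<bar>c\<bar> * P j \<le> \<bar>c\<bar> * P m" by (intro mult_left_mono) auto
    then show ?thesis using cPm Ppos[OF that] by (simp add: abs_mult)
  qed
  have le1: "max 0 (x - b) powr s \<le> 1" if "x \<in> {-1..1}" "s > 0" for x s :: real
    using that \<open>b \<ge> 0\<close> by (intro powr_le1) auto
  have "continuously_differentiable m ?g"
    unfolding continuously_differentiable_def
  proof (intro conjI allI impI)
    fix k assume "k < m"
    then have km: "real k + 1 < r" using m by linarith
    show "nth_deriv k ?g differentiable_on {-1..1}"
      unfolding differentiable_on_def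
    proof
      fix x :: real assume x: "x \<in> {-1..1}"
      have "(\<lambda>t. c * P k * max 0 (t - b) powr (r - real k)) differentiable at x within {-1..1}"
        using DERIV_cmult[OF has_real_derivative_truncated_power[of "r - real k" b x "{-1..1}"]] km
        by (metis add.commute less_diff_eq real_differentiable_def)
      then show "nth_deriv k ?g differentiable at x within {-1..1}"
        by (rule differentiable_transform_within[where d = 1]) (use x \<open>k < m\<close> deriv in auto)
    qed
  next
    have "continuous_on {-1..1} (\<lambda>t. c * P m * max 0 (t - b) powr (r - real m))"
      using m by (intro continuous_intros continuous_on_powr') auto
    then show "continuous_on {-1..1} (nth_deriv m ?g)"
      by (rule continuous_on_eq) (simp add: deriv)
  qed
  moreover have "sup_norm_on {-1..1} (nth_deriv k ?g) \<le> 1" if "k \<le> m" for k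
    unfolding sup_norm_on_def
  proof (rule SUP_least)
    fix x :: real assume x: "x \<in> {-1..1}"
    have "\<bar>c * P k\<bar> * max 0 (x - b) powr (r - real k) \<le> 1 * 1"
      using that m x by (intro mult_mono cP le1) auto
    then show "ereal \<bar>nth_deriv k ?g x\<bar> \<le> 1"
      using deriv[OF that x] by (simp add: abs_mult)
  qed
  \<comment> \<open>For points at distance at most \<open>1\<close> this is Hoelder continuity of the power; for distant points
    the denominator is constant and boundedness by \<open>1\<close> suffices.\<close>
  moreover have "hoelder_seminorm (lip_exponent r) (nth_deriv m ?g) \<le> 1"
    unfolding hoelder_seminorm_def
  proof (rule SUP_least, clarify)
    fix u v :: real assume uv: "u \<in> {-1..1}" "v \<in> {-1..1}" "u \<noteq> v"
    let ?s = "lip_exponent r"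
    let ?U = "max 0 (u - b)" and ?V = "max 0 (v - b)"
    have s: "?s = r - real m" "0 < ?s" "?s \<le> 1"
      using m by (auto simp: lip_exponent_def m_def)
    have "\<bar>?U powr ?s - ?V powr ?s\<bar> \<le> min 1 \<bar>u - v\<bar> powr ?s"
    proof (cases "\<bar>u - v\<bar> \<le> 1")
      case True
      have "\<bar>?U powr ?s - ?V powr ?s\<bar> \<le> \<bar>?U - ?V\<bar> powr ?s"
        using s by (intro abs_diff_powr_le) auto
      also have "\<dots> \<le> \<bar>u - v\<bar> powr ?s"
        using s by (intro powr_mono2) auto
      finally show ?thesis using True by (simp add: min_def)
    next
      case False
      have "?U powr ?s \<le> 1" "?V powr ?s \<le> 1" "0 \<le> ?U powr ?s" "0 \<le> ?V powr ?s"
        using le1 uv s by auto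
      then have "\<bar>?U powr ?s - ?V powr ?s\<bar> \<le> 1" by linarith
      then show ?thesis using False by simp
    qed
    then have "\<bar>c * P m\<bar> * \<bar>?U powr ?s - ?V powr ?s\<bar> \<le> 1 * min 1 \<bar>u - v\<bar> powr ?s"
      by (intro mult_mono cP) auto
    moreover have "nth_deriv m ?g u - nth_deriv m ?g v = c * P m * (?U powr ?s - ?V powr ?s)"
      using deriv[of m u] deriv[of m v] uv by (simp add: s(1) right_diff_distrib)
    ultimately have "\<bar>nth_deriv m ?g u - nth_deriv m ?g v\<bar> \<le> min 1 \<bar>u - v\<bar> powr ?s"
      by (simp add: abs_mult)
    moreover have "0 < min 1 \<bar>u - v\<bar> powr ?s" using uv by simp
    ultimately show "ereal (\<bar>nth_deriv m ?g u - nth_deriv m ?g v\<bar> / (2 * min 1 \<bar>u - v\<bar> powr ?s)) \<le> 1"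
      by (simp add: divide_le_eq)
  qed
  ultimately show ?thesis
    unfolding lip_ball_def lip_norm_def m_def by simp
qed

section \<open>Sign vectors with small inner products\<close>

text \<open>
  Termwise comparison of the power series, since \<open>2\<^sup>n n! \<le> (2n)!\<close>.
\<close>

lemma cosh_le_exp_half_square:
  fixes x :: real
  shows "cosh x \<le> exp (x\<^sup>2 / 2)"
proof -
  have "(\<lambda>n. if even n then x ^ n /\<^sub>R fact n else 0) sums cosh x"
    by (rule cosh_converges)
  then have "(\<lambda>n. (\<lambda>n. if even n then x ^ n /\<^sub>R fact n else 0) (2 * n)) sums cosh x"
    by (subst sums_mono_reindex) (auto simp: strict_mono_def elim!: evenE)
  then have 1: "(\<lambda>n. x ^ (2 * n) / fact (2 * n)) sums cosh x"
    by (simp add: field_simps)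
  have 2: "(\<lambda>n. (x\<^sup>2 / 2) ^ n / fact n) sums exp (x\<^sup>2 / 2)"
    using exp_converges[of "x\<^sup>2 / 2"] by (simp add: field_simps)
  have fact: "2 ^ n * fact n \<le> (fact (2 * n) :: real)" for n
  proof (induction n)
    case (Suc n)
    have "2 ^ Suc n * fact (Suc n) = (2 * real n + 2) * (2 ^ n * fact n)"
      by (simp add: algebra_simps)
    also have "\<dots> \<le> (2 * real n + 2) * (1 * fact (2 * n))"
      using Suc by (intro mult_left_mono) auto
    also have "\<dots> \<le> (2 * real n + 2) * ((2 * real n + 1) * fact (2 * n))"
      by (intro mult_left_mono mult_right_mono) auto
    also have "\<dots> = fact (2 * Suc n)" by (simp add: algebra_simps)
    finally show ?case .
  qed simp
  show ?thesis
  proof (rule sums_le[OF _ 1 2])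
    fix n
    have "x ^ (2 * n) / fact (2 * n) \<le> x ^ (2 * n) / (2 ^ n * fact n)"
      using fact[of n] by (intro divide_left_mono) auto
    then show "x ^ (2 * n) / fact (2 * n) \<le> (x\<^sup>2 / 2) ^ n / fact n"
      by (simp add: power_mult power_divide)
  qed
qed

text \<open>
  This is the moment generating function bound behind Hoeffding's inequality, with the expectation
  over random signs replaced by a greedy choice. Fixing one more sign multiplies each summand by
  \<open>exp (\<plusminus>s x)\<close>; the average over the two signs multiplies it by \<open>cosh (s x) \<le> exp (s\<^sup>2/2)\<close>, and
  the better of the two signs is no worse than the average.
\<close>

lemma exists_signs_exp_sum_le:
  fixes x :: "'i \<Rightarrow> 'j \<Rightarrow> real" and s :: real
  assumes "finite K" "finite I" and x: "\<And>i j. i \<in> I \<Longrightarrow> \<bar>x i j\<bar> \<le> 1"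
  shows "\<exists>\<epsilon> :: 'j \<Rightarrow> real. (\<forall>j. \<epsilon> j \<in> {-1, 1}) \<and>
           (\<Sum>i\<in>I. exp (s * (\<Sum>j\<in>K. \<epsilon> j * x i j))) \<le> real (card I) * exp (s\<^sup>2 / 2 * real (card K))"
  using \<open>finite K\<close>
proof induction
  case empty
  show ?case by (intro exI[of _ "\<lambda>_. 1"]) simp
next
  case (insert l K)
  then obtain \<epsilon> :: "'j \<Rightarrow> real" where \<epsilon>: "\<forall>j. \<epsilon> j \<in> {-1, 1}"
    and IH: "(\<Sum>i\<in>I. exp (s * (\<Sum>j\<in>K. \<epsilon> j * x i j))) \<le> real (card I) * exp (s\<^sup>2 / 2 * real (card K))"
    by blast
  define w where "w i = exp (s * (\<Sum>j\<in>K. \<epsilon> j * x i j))" for i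
  define T where "T \<sigma> = (\<Sum>i\<in>I. w i * exp (s * (\<sigma> * x i l)))" for \<sigma>
  have "(T 1 + T (-1)) / 2 = (\<Sum>i\<in>I. w i * cosh (s * x i l))"
    unfolding T_def
    by (simp add: cosh_def sum.distrib[symmetric] sum_divide_distrib ring_distribs add_divide_distrib)
  also have "\<dots> \<le> (\<Sum>i\<in>I. w i * exp (s\<^sup>2 / 2))"
  proof (intro sum_mono mult_left_mono)
    fix i assume "i \<in> I"
    have "cosh (s * x i l) \<le> exp ((s * x i l)\<^sup>2 / 2)" by (rule cosh_le_exp_half_square)
    also have "\<dots> \<le> exp (s\<^sup>2 / 2)"
    proof -
      have "(x i l)\<^sup>2 \<le> 1" using x[OF \<open>i \<in> I\<close>] abs_square_le_1 by blast
      then show ?thesis by (simp add: power_mult_distrib mult_left_le)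
    qed
    finally show "cosh (s * x i l) \<le> exp (s\<^sup>2 / 2)" .
  qed (simp add: w_def)
  also have "\<dots> = (\<Sum>i\<in>I. w i) * exp (s\<^sup>2 / 2)" by (simp add: sum_distrib_right)
  also have "\<dots> \<le> real (card I) * exp (s\<^sup>2 / 2 * real (card K)) * exp (s\<^sup>2 / 2)"
    using IH by (intro mult_right_mono) (auto simp: w_def)
  also have "\<dots> = real (card I) * exp (s\<^sup>2 / 2 * real (card (insert l K)))"
    using insert.hyps by (simp add: algebra_simps flip: exp_add)
  finally have "min (T 1) (T (-1)) \<le> real (card I) * exp (s\<^sup>2 / 2 * real (card (insert l K)))"
    by (rule order_trans[rotated]) (simp add: min_def)
  then obtain \<sigma> where \<sigma>: "\<sigma> \<in> {-1, 1}"
    "T \<sigma> \<le> real (card I) * exp (s\<^sup>2 / 2 * real (card (insert l K)))"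
    by (auto simp: min_le_iff_disj)
  have "(\<Sum>j\<in>insert l K. (\<epsilon>(l := \<sigma>)) j * x i j) = \<sigma> * x i l + (\<Sum>j\<in>K. \<epsilon> j * x i j)" for i
  proof -
    have "(\<Sum>j\<in>K. (\<epsilon>(l := \<sigma>)) j * x i j) = (\<Sum>j\<in>K. \<epsilon> j * x i j)"
      using insert.hyps by (intro sum.cong) auto
    then show ?thesis using insert.hyps by simp
  qed
  then have "(\<Sum>i\<in>I. exp (s * (\<Sum>j\<in>insert l K. (\<epsilon>(l := \<sigma>)) j * x i j))) = T \<sigma>"
    unfolding T_def w_def by (simp add: algebra_simps exp_add)
  then show ?case using \<sigma> \<epsilon> by (intro exI[of _ "\<epsilon>(l := \<sigma>)"]) auto
qed

text \<open>
  Every summand of the exponential sum is bounded by the whole sum; taking logarithms gives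
  \<open>2 ln n + k/4\<close> for each inner product, and the hypothesis makes the first term at most \<open>k/4\<close>.
\<close>

lemma exists_signs_inner_le_half:
  fixes x :: "nat \<Rightarrow> 'j \<Rightarrow> real"
  assumes "finite K" "n \<ge> 1" "8 * ln (real n) \<le> real (card K)"
    and x: "\<And>i j. i < n \<Longrightarrow> \<bar>x i j\<bar> \<le> 1"
  shows "\<exists>\<epsilon> :: 'j \<Rightarrow> real. (\<forall>j. \<epsilon> j \<in> {-1, 1}) \<and>
           (\<forall>i<n. (\<Sum>j\<in>K. \<epsilon> j * x i j) \<le> real (card K) / 2)"
proof -
  \<comment> \<open>\<open>s = 1/2\<close> is the optimal parameter for the deviation \<open>k/2\<close>: it minimises \<open>s\<^sup>2 k/2 - s k/2\<close>.\<close>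
  obtain \<epsilon> :: "'j \<Rightarrow> real" where \<epsilon>: "\<forall>j. \<epsilon> j \<in> {-1, 1}" and
    sum: "(\<Sum>i<n. exp (1/2 * (\<Sum>j\<in>K. \<epsilon> j * x i j))) \<le> real n * exp ((1/2)\<^sup>2 / 2 * real (card K))"
    using exists_signs_exp_sum_le[of K "{..<n}" x "1/2"] assms by auto
  have "(\<Sum>j\<in>K. \<epsilon> j * x i j) \<le> real (card K) / 2" if "i < n" for i
  proof -
    have "exp (1/2 * (\<Sum>j\<in>K. \<epsilon> j * x i j)) \<le> (\<Sum>i<n. exp (1/2 * (\<Sum>j\<in>K. \<epsilon> j * x i j)))"
      by (rule member_le_sum) (use that in auto)
    also note sum
    also have "real n * exp ((1/2)\<^sup>2 / 2 * real (card K)) = exp (ln (real n) + real (card K) / 8)"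
      using \<open>n \<ge> 1\<close> by (simp add: exp_add power2_eq_square)
    finally have "1/2 * (\<Sum>j\<in>K. \<epsilon> j * x i j) \<le> ln (real n) + real (card K) / 8" by simp
    then show ?thesis using assms(3) by linarith
  qed
  then show ?thesis using \<epsilon> by blast
qed

section \<open>Fooling an adaptive algorithm\<close>

text \<open>
  Adaptivity does not help against functions that vanish at every visited point: the information
  is then a list of zeros, so the points visited are the fixed points \<open>\<psi> (replicate i 0)\<close>.
\<close>

lemma err_ge_fooling:
  fixes F :: "(real ^ 'd::finite \<Rightarrow> real) set"
  assumes fool: "\<And>x :: nat \<Rightarrow> real ^ 'd. (\<And>i. i < n \<Longrightarrow> x i \<in> cube) \<Longrightarrow>
      \<exists>f\<in>F. (\<lambda>z. - f z) \<in> F \<and> (\<forall>i<n. f (x i) = 0) \<and> (\<exists>z\<in>cube. \<delta> \<le> f z)"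
  shows "err n F \<ge> ereal \<delta>"
  unfolding err_def
proof (rule INF_greatest)
  fix S :: "(real ^ 'd \<Rightarrow> real) \<Rightarrow> (real ^ 'd \<Rightarrow> real)"
  assume "S \<in> algorithms n"
  then obtain \<psi> \<phi> where \<psi>: "\<And>ys. length ys < n \<Longrightarrow> \<psi> ys \<in> cube"
    and S: "S = (\<lambda>f. \<phi> (information \<psi> f n))"
    unfolding algorithms_def by blast
  obtain f z where f: "f \<in> F" "(\<lambda>z. - f z) \<in> F" "\<forall>i<n. f (\<psi> (replicate i 0)) = 0"
    and z: "z \<in> cube" "\<delta> \<le> f z"
    using fool[of "\<lambda>i. \<psi> (replicate i 0)"] \<psi> by auto
  have info: "information \<psi> h i = replicate i 0"
    if "\<forall>i<n. h (\<psi> (replicate i 0)) = 0" "i \<le> n" for h i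
    using that(2) by (induction i) (use that(1) in \<open>auto simp flip: replicate_append_same\<close>)
  define y where "y = \<phi> (replicate n 0) z"
  have Sf: "S f z = y" "S (\<lambda>z. - f z) z = y"
    using info f unfolding S y_def by auto
  have bound: "ereal \<bar>h z - S h z\<bar> \<le> (SUP f\<in>F. sup_norm_on cube (\<lambda>x. f x - S f x))"
    if "h \<in> F" for h
    using that z(1) unfolding sup_norm_on_def
    by (meson SUP_upper SUP_upper2)
  have "\<delta> \<le> max \<bar>f z - y\<bar> \<bar>- f z - y\<bar>" using z(2) by linarith
  then have "ereal \<delta> \<le> ereal \<bar>f z - S f z\<bar> \<or> ereal \<delta> \<le> ereal \<bar>- f z - S (\<lambda>z. - f z) z\<bar>"
    unfolding Sf by (simp add: le_max_iff_disj)
  then show "ereal \<delta> \<le> (SUP f\<in>F. sup_norm_on cube (\<lambda>x. f x - S f x))"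
    using bound[OF f(1)] bound[OF f(2)] by (meson order_trans)
qed

section \<open>The lower bound\<close>

text \<open>
  The trade-off in the size of \<open>K\<close> is explicit here: a large set is needed to hide the ridge from
  \<open>n\<close> points, but for \<open>p < 1\<close> spreading the unit \<open>p\<close>-norm over more coordinates lowers the
  height that the ridge can reach.
\<close>

lemma err_ridge_class_ge:
  fixes r p :: real and K :: "'d::finite set"
  assumes "r > 0" "p > 0" "K \<noteq> {}" "n \<ge> 1" and K: "8 * ln (real n) \<le> real (card K)"
  shows "err n (ridge_class r p :: (real ^ 'd \<Rightarrow> real) set)
           \<ge> ereal (lower_const r * (1 / real (card K)) powr (r * (1 / p - 1)))"
proof (rule err_ge_fooling)
  fix x :: "nat \<Rightarrow> real ^ 'd"
  assume x: "\<And>i. i < n \<Longrightarrow> x i \<in> cube"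
  define k where "k = real (card K)"
  have k: "k > 0" using \<open>K \<noteq> {}\<close> by (simp add: k_def card_gt_0_iff)
  have "\<bar>x i $ j\<bar> \<le> 1" if "i < n" for i j
    using x[OF that] unfolding cube_def by (simp add: abs_le_iff minus_le_iff)
  then obtain \<epsilon> :: "'d \<Rightarrow> real" where \<epsilon>: "\<And>j. \<epsilon> j \<in> {-1, 1}"
    and half: "\<And>i. i < n \<Longrightarrow> (\<Sum>j\<in>K. \<epsilon> j * x i $ j) \<le> k / 2"
    using exists_signs_inner_le_half[of K n "\<lambda>i j. x i $ j"] assms by (auto simp: k_def)
  define a :: "real ^ 'd" where "a = (\<chi> j. if j \<in> K then \<epsilon> j * k powr (- (1 / p)) else 0)"
  define b where "b = k powr (1 - 1 / p) / 2"
  define C where "C = Gamma (r + 1 - real (lip_order r)) / Gamma (r + 1)"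
  have "C > 0" unfolding C_def
    using lip_order_bounds(1)[OF \<open>r > 0\<close>] \<open>r > 0\<close> by (intro divide_pos_pos Gamma_real_pos) auto
  have inner: "a \<bullet> z = k powr (- (1 / p)) * (\<Sum>j\<in>K. \<epsilon> j * z $ j)" for z
  proof -
    have "a \<bullet> z = (\<Sum>j\<in>K. \<epsilon> j * k powr (- (1 / p)) * z $ j)"
      unfolding inner_vec_def a_def
      by (simp add: if_distrib[of "\<lambda>t. t * _"] sum.If_cases cong: if_cong)
    then show ?thesis by (simp add: sum_distrib_left algebra_simps)
  qed
  have kb: "k powr (- (1 / p)) * k = 2 * b"
    using k by (simp add: b_def powr_diff powr_minus field_simps)
  have a1: "p_norm p a = 1"
  proof -
    have \<epsilon>1: "\<bar>\<epsilon> j\<bar> = 1" for j using \<epsilon>[of j] by auto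
    have "(\<Sum>j\<in>UNIV. \<bar>a $ j\<bar> powr p) = (\<Sum>j\<in>UNIV. if j \<in> K then 1 / k else 0)"
    proof (intro sum.cong refl)
      fix j
      have "(k powr (- (1 / p))) powr p = 1 / k"
        unfolding powr_powr using k \<open>p > 0\<close> by (simp add: powr_minus_divide)
      then show "\<bar>a $ j\<bar> powr p = (if j \<in> K then 1 / k else 0)"
        by (simp add: a_def abs_mult \<epsilon>1)
    qed
    also have "\<dots> = 1" using k by (simp add: sum.If_cases flip: k_def)
    finally show ?thesis by (simp add: p_norm_def)
  qed
  define f where "f \<sigma> z = \<sigma> * C * max 0 (a \<bullet> z - b) powr r" for \<sigma> z
  have mem: "f \<sigma> \<in> ridge_class r p" if "\<bar>\<sigma>\<bar> = 1" for \<sigma>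
  proof -
    have "(\<lambda>t. \<sigma> * C * max 0 (t - b) powr r) \<in> lip_ball r"
      using \<open>r > 0\<close> \<open>C > 0\<close> that by (intro truncated_power_in_lip_ball) (auto simp: b_def C_def abs_mult)
    then show ?thesis
      unfolding ridge_class_def
      by (intro CollectI bexI[of _ "\<lambda>t. \<sigma> * C * max 0 (t - b) powr r"] exI[of _ a] conjI ballI a1)
        (simp_all add: f_def)
  qed
  have zero: "f 1 (x i) = 0" if "i < n" for i
  proof -
    have "a \<bullet> x i \<le> k powr (- (1 / p)) * (k / 2)"
      unfolding inner using half[OF that] by (intro mult_left_mono) auto
    then have "a \<bullet> x i \<le> b" using kb by simp
    then show ?thesis by (simp add: f_def)
  qed
  define e :: "real ^ 'd" where "e = (\<chi> j. \<epsilon> j)"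
  have "-1 \<le> \<epsilon> j \<and> \<epsilon> j \<le> 1" for j using \<epsilon>[of j] by auto
  then have "e \<in> cube" by (simp add: cube_def e_def)
  have "a \<bullet> e = 2 * b"
  proof -
    have "\<epsilon> j * \<epsilon> j = 1" for j using \<epsilon>[of j] by auto
    then show ?thesis unfolding inner e_def using kb by (simp add: k_def)
  qed
  then have "f 1 e = C * b powr r" by (simp add: f_def b_def)
  also have "\<dots> = lower_const r * (1 / k) powr (r * (1 / p - 1))"
  proof -
    have "b powr r = k powr ((1 - 1 / p) * r) / 2 powr r"
      using k by (simp add: b_def powr_divide powr_powr)
    moreover have "(1 / k) powr (r * (1 / p - 1)) = k powr (- (r * (1 / p - 1)))"
      using k by (simp add: powr_divide powr_minus_divide)
    moreover have "(1 - 1 / p) * r = - (r * (1 / p - 1))" by (simp add: algebra_simps)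
    ultimately show ?thesis
      unfolding lower_const_def C_def[symmetric] by (simp add: powr_minus_divide)
  qed
  finally have "lower_const r * (1 / k) powr (r * (1 / p - 1)) \<le> f 1 e" by simp
  moreover have "(\<lambda>z. - f 1 z) = f (-1)" by (simp add: f_def fun_eq_iff)
  ultimately show "\<exists>f\<in>ridge_class r p. (\<lambda>z. - f z) \<in> ridge_class r p \<and> (\<forall>i<n. f (x i) = 0) \<and>
      (\<exists>z\<in>cube. lower_const r * (1 / real (card K)) powr (r * (1 / p - 1)) \<le> f z)"
    using mem[of 1] mem[of "-1"] zero \<open>e \<in> cube\<close> unfolding k_def
    by (intro bexI[of _ "f 1"]) auto
qed

lemma lower_const_of_nat:
  assumes "k > 0"
  shows "lower_const (real k) = 2 powr (- real k) / fact k"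
proof -
  have "lip_order (real k) = k - 1"
    unfolding lip_order_def using assms by (intro Greatest_equality) auto
  then have "Gamma (real k + 1 - real (lip_order (real k))) = 1"
    using assms Gamma_fact[of 1, where 'a = real] by (simp add: of_nat_diff)
  moreover have "Gamma (real k + 1) = fact k"
    using Gamma_fact[of k, where 'a = real] by (simp add: add.commute)
  ultimately show ?thesis by (simp add: lower_const_def)
qed

theorem theorem8:
  fixes r p :: real
  assumes "r > 0" and "0 < p" and "p \<le> 1"
  shows "(\<forall>n::nat. 1 \<le> n \<and> real n < exp (real CARD('d) / 8) \<longrightarrow>
            err n (ridge_class r p :: (real ^ 'd::finite \<Rightarrow> real) set)
              \<ge> ereal (lower_const r * (1 / (8 * ln (2 * real n))) powr (r * (1 / p - 1))))
         \<and> (\<forall>k::nat. r = real k \<longrightarrow> lower_const r = 2 powr (- r) / fact k)"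
proof (intro conjI allI impI)
  fix n :: nat
  assume n: "1 \<le> n \<and> real n < exp (real CARD('d) / 8)"
  \<comment> \<open>Rounding strictly up keeps \<open>k\<close> positive for \<open>n = 1\<close>.\<close>
  define k where "k = nat \<lfloor>8 * ln (real n)\<rfloor> + 1"
  have ln0: "0 \<le> ln (real n)" using n by simp
  then have k: "8 * ln (real n) \<le> real k" "real k \<le> 8 * ln (real n) + 1"
    unfolding k_def by linarith+
  have "ln (real n) < real CARD('d) / 8"
    using n by (metis exp_less_cancel_iff exp_ln_iff less_le_trans less_numeral_extra(1) of_nat_1 of_nat_le_iff)
  then have "k \<le> CARD('d)" unfolding k_def using ln0 by linarith
  then obtain K :: "'d set" where K: "card K = k" using obtain_subset_with_card_n by blast
  have "K \<noteq> {}" using K by (auto simp: k_def)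
  have "1/2 < ln (2 :: real)"
    using ln2_ge_two_thirds by simp
  then have kle: "real k \<le> 8 * ln (2 * real n)" using n k by (simp add: ln_mult)
  have "0 \<le> r * (1 / p - 1)" using assms by simp
  moreover have "1 / (8 * ln (2 * real n)) \<le> 1 / real k"
    using kle by (intro divide_left_mono) (auto simp: k_def)
  moreover have "0 \<le> 1 / (8 * ln (2 * real n))" using n by simp
  ultimately have "(1 / (8 * ln (2 * real n))) powr (r * (1 / p - 1)) \<le> (1 / real k) powr (r * (1 / p - 1))"
    by (intro powr_mono2)
  moreover have "0 \<le> lower_const r"
    unfolding lower_const_def using lip_order_bounds(1)[OF \<open>r > 0\<close>] \<open>r > 0\<close>
    by (intro mult_nonneg_nonneg divide_nonneg_nonneg less_imp_le[OF Gamma_real_pos]) auto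
  ultimately have "ereal (lower_const r * (1 / (8 * ln (2 * real n))) powr (r * (1 / p - 1)))
      \<le> ereal (lower_const r * (1 / real (card K)) powr (r * (1 / p - 1)))"
    unfolding K by (simp add: mult_left_mono)
  also have "\<dots> \<le> err n (ridge_class r p :: (real ^ 'd \<Rightarrow> real) set)"
    using assms n k \<open>K \<noteq> {}\<close> K by (intro err_ridge_class_ge) auto
  finally show "err n (ridge_class r p :: (real ^ 'd \<Rightarrow> real) set)
      \<ge> ereal (lower_const r * (1 / (8 * ln (2 * real n))) powr (r * (1 / p - 1)))" .
next
  fix k :: nat
  assume "r = real k"
  then show "lower_const r = 2 powr (- r) / fact k"
    using lower_const_of_nat[of k] \<open>r > 0\<close> by simp
qed

end
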